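(* Let $\alpha,\beta$ be real numbers. The double inequality $$\alpha D(a,b)+(1-\alpha)H(a,b)<T(a,b)<\beta D(a,b)+(1-\beta)H(a,b)$$ holds for all $a,b>0$ with $a\neq b$ if and only if $\alpha\leq 4/9$ and $\beta\geq 2/\pi$.
   Context: For real $a,b>0$ with $a\neq b$: $H(a,b)=\dfrac{2ab}{a+b}$ is the harmonic mean, $T(a,b)=\dfrac{a-b}{2\arctan\left(\frac{a-b}{a+b}\right)}$ is the Seiffert mean, and $D(a,b)=\dfrac{a^3+b^3}{a^2+b^2}$ is the second contraharmonic mean. *)

theory Defs
  imports Complex_Main
begin

definition harmonic_mean :: "real \<Rightarrow> real \<Rightarrow> real" where
  "harmonic_mean a b = 2 * a * b / (a + b)"

text \<open>Intended for \<open>a \<noteq> b\<close> only: on the diagonal the formula is \<open>0 / 0 = 0\<close>, not the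
  limiting value \<open>a\<close>.\<close>

definition seiffert_mean :: "real \<Rightarrow> real \<Rightarrow> real" where
  "seiffert_mean a b = (a - b) / (2 * arctan ((a - b) / (a + b)))"

definition second_contraharmonic_mean :: "real \<Rightarrow> real \<Rightarrow> real" where
  "second_contraharmonic_mean a b = (a ^ 3 + b ^ 3) / (a\<^sup>2 + b\<^sup>2)"

end

theory Submission
  imports Defs
begin

text \<open>
  All three means are symmetric and homogeneous, so for \<open>a > b\<close> one may write \<open>a = A (1 + x)\<close> and
  \<open>b = A (1 - x)\<close> with \<open>x = (a - b) / (a + b)\<close> between \<open>0\<close> and \<open>1\<close>. Dividing by \<open>A\<close> turns the
  Seiffert mean into \<open>x / arctan x\<close> and the combination with weight \<open>p\<close> into
  \<open>P(x\<^sup>2) / (1 + x\<^sup>2)\<close>, where \<open>P(t) = 1 + 3 p t - (1 - p) t\<^sup>2\<close>. Thus everything is a comparison of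
  \<open>arctan x\<close> with the rational function \<open>r(x) = x (1 + x\<^sup>2) / P(x\<^sup>2)\<close>, and
  \<open>r'(x) - arctan'(x)\<close> has, for \<open>0 < p < 1\<close> and \<open>0 < x \<le> 1\<close>, the sign of the cubic
  \<open>q(t) = (4 - 9 p) + (8 - 5 p - 9 p\<^sup>2) t + (4 + 5 p - 6 p\<^sup>2) t\<^sup>2 + p (1 - p) t\<^sup>3\<close> at \<open>t = x\<^sup>2\<close>.
  For \<open>0 < p \<le> 2 / 3\<close> every coefficient but the constant one is positive, so \<open>q\<close> is strictly
  increasing on the nonnegative reals.

  For \<open>p = 4 / 9\<close> the constant coefficient vanishes, so \<open>q > 0\<close> and \<open>r - arctan\<close> increases
  from \<open>0\<close>. For \<open>p = 2 / \<pi>\<close> the difference \<open>r - arctan\<close> vanishes at both \<open>0\<close> and \<open>1\<close>; since its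
  derivative changes sign at most once, from negative to positive, the difference is negative in
  between. Other weights are covered because the combination is increasing in \<open>p\<close>.
  Conversely, letting \<open>x\<close> tend to \<open>0\<close> forces \<open>\<alpha> \<le> 4 / 9\<close>, and letting it tend to \<open>1\<close> forces
  \<open>\<beta> \<ge> 2 / \<pi>\<close>.
\<close>

section \<open>Reduction to one variable\<close>

text \<open>The value of the affine combination with weight \<open>p\<close> of the second contraharmonic and the
  harmonic mean at the pair \<open>1 + x\<close>, \<open>1 - x\<close>, whose arithmetic mean is \<open>1\<close>.\<close>

definition mix :: "real \<Rightarrow> real \<Rightarrow> real" where
  "mix p x = (1 + 3 * p * x^2 - (1 - p) * x^4) / (1 + x^2)"

lemma combination_eq_mix:
  assumes "A > 0"
  shows "p * second_contraharmonic_mean (A * (1 + x)) (A * (1 - x))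
           + (1 - p) * harmonic_mean (A * (1 + x)) (A * (1 - x)) = A * mix p x"
proof -
  have pos: "1 + x^2 > 0" by (simp add: add_pos_nonneg)
  have "(A * (1 + x))^3 + (A * (1 - x))^3 = (2 * A^2) * (A * (1 + 3 * x^2))"
       "(A * (1 + x))^2 + (A * (1 - x))^2 = (2 * A^2) * (1 + x^2)"
    by (simp_all add: algebra_simps power2_eq_square power3_eq_cube)
  then have D: "second_contraharmonic_mean (A * (1 + x)) (A * (1 - x))
      = A * (1 + 3 * x^2) / (1 + x^2)"
    unfolding second_contraharmonic_mean_def using assms by simp
  have "A * (1 + x) + A * (1 - x) = 2 * A"
    by (simp add: algebra_simps)
  moreover have "2 * (A * (1 + x)) * (A * (1 - x)) = (2 * A) * (A * (1 - x^2))"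
    by (simp add: algebra_simps power2_eq_square)
  ultimately have H: "harmonic_mean (A * (1 + x)) (A * (1 - x)) = A * (1 - x^2)"
    unfolding harmonic_mean_def using assms by simp
  show ?thesis
    unfolding D H mix_def using pos by (simp add: field_simps)
qed

lemma seiffert_mean_eq:
  assumes "A > 0"
  shows "seiffert_mean (A * (1 + x)) (A * (1 - x)) = A * (x / arctan x)"
proof -
  have "A * (1 + x) - A * (1 - x) = 2 * A * x" "A * (1 + x) + A * (1 - x) = 2 * A"
    by (simp_all add: algebra_simps)
  then show ?thesis
    unfolding seiffert_mean_def using assms by simp
qed

lemma means_commute:
  "harmonic_mean a b = harmonic_mean b a"
  "second_contraharmonic_mean a b = second_contraharmonic_mean b a"
  "seiffert_mean a b = seiffert_mean b a"
proof -
  show "harmonic_mean a b = harmonic_mean b a"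
       "second_contraharmonic_mean a b = second_contraharmonic_mean b a"
    by (simp_all add: harmonic_mean_def second_contraharmonic_mean_def algebra_simps)
  have "(a - b) / (a + b) = - ((b - a) / (b + a))"
    by (simp add: add.commute minus_divide_left)
  then have "arctan ((a - b) / (a + b)) = - arctan ((b - a) / (b + a))"
    by (simp only: arctan_minus)
  then show "seiffert_mean a b = seiffert_mean b a"
    unfolding seiffert_mean_def by (metis minus_diff_eq minus_divide_divide mult_minus_right)
qed

lemma mean_inequality_iff_mix:
  "(\<forall>a b :: real. a > 0 \<longrightarrow> b > 0 \<longrightarrow> a \<noteq> b \<longrightarrow>
      \<alpha> * second_contraharmonic_mean a b + (1 - \<alpha>) * harmonic_mean a b < seiffert_mean a b \<and>
      seiffert_mean a b < \<beta> * second_contraharmonic_mean a b + (1 - \<beta>) * harmonic_mean a b)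
   \<longleftrightarrow> (\<forall>x. 0 < x \<longrightarrow> x < 1 \<longrightarrow> mix \<alpha> x < x / arctan x \<and> x / arctan x < mix \<beta> x)"
   (is "(\<forall>a b. a > 0 \<longrightarrow> b > 0 \<longrightarrow> a \<noteq> b \<longrightarrow> ?P a b) \<longleftrightarrow> ?R")
proof
  assume L: "\<forall>a b. a > 0 \<longrightarrow> b > 0 \<longrightarrow> a \<noteq> b \<longrightarrow> ?P a b"
  show ?R
  proof (intro allI impI)
    fix x :: real assume "0 < x" "x < 1"
    then have "?P (1 * (1 + x)) (1 * (1 - x))"
      using L[rule_format, of "1 * (1 + x)" "1 * (1 - x)"] by simp
    then show "mix \<alpha> x < x / arctan x \<and> x / arctan x < mix \<beta> x"
      unfolding combination_eq_mix[OF zero_less_one] seiffert_mean_eq[OF zero_less_one]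
    by simp
  qed
next
  assume R: ?R
  have *: "?P a b" if "b > 0" "a > b" for a b
  proof -
    define A where "A = (a + b) / 2"
    define x where "x = (a - b) / (a + b)"
    have A: "A > 0" and x: "0 < x" "x < 1"
      using that by (simp_all add: A_def x_def)
    have "A * x = (a - b) / 2"
      using that unfolding A_def x_def times_divide_times_eq
      by (subst frac_eq_eq) auto
    then have ab: "a = A * (1 + x)" "b = A * (1 - x)"
      by (simp_all add: A_def distrib_left right_diff_distrib field_simps)
    show ?thesis
      unfolding ab combination_eq_mix[OF A] seiffert_mean_eq[OF A]
      using R x A by (simp del: times_divide_eq_right)
  qed
  show "\<forall>a b. a > 0 \<longrightarrow> b > 0 \<longrightarrow> a \<noteq> b \<longrightarrow> ?P a b"
  proof (intro allI impI)
    fix a b :: real assume "a > 0" "b > 0" "a \<noteq> b"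
    then consider "a > b" | "b > a" by linarith
    then show "?P a b"
    proof cases
      case 1
      then show ?thesis using *[of b a] \<open>b > 0\<close> by simp
    next
      case 2
      then show ?thesis using *[of a b] \<open>a > 0\<close>
        by (simp only: means_commute[of a b])
    qed
  qed
qed

lemma mix_mono: "p \<le> p' \<Longrightarrow> mix p x \<le> mix p' x"
proof -
  assume "p \<le> p'"
  then have "p * (3 * x^2 + x^4) \<le> p' * (3 * x^2 + x^4)"
    by (intro mult_right_mono) auto
  then show "mix p x \<le> mix p' x"
    unfolding mix_def by (intro divide_right_mono) (auto simp: algebra_simps)
qed

section \<open>Comparison of the arctangent with a rational function\<close>

lemma mix_denominator_pos:
  fixes x :: real
  assumes "0 < p" "p < 1" "0 \<le> x" "x \<le> 1"
  shows "1 + 3 * p * x^2 - (1 - p) * x^4 > 0"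
proof -
  have "x^4 \<le> 1" using assms by (simp add: power_le_one)
  then have "(1 - p) * x^4 \<le> (1 - p) * 1"
    using assms by (intro mult_left_mono) auto
  moreover have "3 * p * x^2 \<ge> 0" using assms by simp
  ultimately show ?thesis using assms(1) unfolding mult_1_right by linarith
qed

text \<open>The cubic that carries the sign of the derivative of \<open>x / mix p x - arctan x\<close>,
  as a function of \<open>t = x\<^sup>2\<close>.\<close>

definition slope_cubic :: "real \<Rightarrow> real \<Rightarrow> real" where
  "slope_cubic p t = (4 - 9 * p) + (8 - 5 * p - 9 * p^2) * t
     + (4 + 5 * p - 6 * p^2) * t^2 + p * (1 - p) * t^3"

lemma slope_cubic_strict_mono:
  assumes p: "0 < p" "p \<le> 2 / 3" and st: "0 \<le> s" "s < t"
  shows "slope_cubic p s < slope_cubic p t"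
proof -
  have pp: "p^2 \<le> (2 / 3)^2" using p by (intro power_mono) auto
  have "8 - 5 * p - 9 * p^2 > 0" "4 + 5 * p - 6 * p^2 > 0"
    using p pp by (simp_all add: power2_eq_square)
  moreover have "s^2 \<le> t^2" "s^3 \<le> t^3"
    using st by (auto intro: power_mono)
  ultimately show ?thesis
    unfolding slope_cubic_def using p st
    by (intro add_less_le_mono mult_left_mono add_strict_left_mono mult_strict_left_mono) auto
qed

lemma DERIV_ratio_minus_arctan:
  assumes p: "0 < p" "p < 1" and x: "0 \<le> x" "x \<le> 1"
  shows "((\<lambda>x. x / mix p x - arctan x) has_real_derivative
     x^2 * slope_cubic p (x^2) / ((1 + 3 * p * x^2 - (1 - p) * x^4)^2 * (1 + x^2))) (at x)"
proof -
  define Q where "Q = 1 + 3 * p * x^2 - (1 - p) * x^4"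
  have Q: "Q \<noteq> 0"
    using mix_denominator_pos[OF assms] by (simp add: Q_def)
  have S: "1 + x^2 > 0" by (simp add: add_pos_nonneg)
  have eq: "(\<lambda>x. x / mix p x - arctan x)
      = (\<lambda>x. x * (1 + x^2) / (1 + 3 * p * x^2 - (1 - p) * x^4) - arctan x)"
    by (simp add: mix_def)
  have "((\<lambda>x. x * (1 + x^2)) has_real_derivative 1 + 3 * x^2) (at x)"
    by (auto intro!: derivative_eq_intros simp: power2_eq_square)
  moreover have "((\<lambda>x. 1 + 3 * p * x^2 - (1 - p) * x^4) has_real_derivative
      6 * p * x - 4 * (1 - p) * x^3) (at x)"
    by (auto intro!: derivative_eq_intros)
  ultimately have "((\<lambda>x. x * (1 + x^2) / (1 + 3 * p * x^2 - (1 - p) * x^4)) has_real_derivative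
      ((1 + 3 * x^2) * Q - x * (1 + x^2) * (6 * p * x - 4 * (1 - p) * x^3)) / (Q * Q)) (at x)"
    using Q unfolding Q_def by (rule DERIV_divide)
  from DERIV_diff[OF this DERIV_arctan]
  have "((\<lambda>x. x * (1 + x^2) / (1 + 3 * p * x^2 - (1 - p) * x^4) - arctan x) has_real_derivative
     ((1 + 3 * x^2) * Q - x * (1 + x^2) * (6 * p * x - 4 * (1 - p) * x^3)) / Q^2 - 1 / (1 + x^2)) (at x)"
    by (simp add: power2_eq_square inverse_eq_divide)
  moreover have "((1 + 3 * x^2) * Q - x * (1 + x^2) * (6 * p * x - 4 * (1 - p) * x^3)) / Q^2 - 1 / (1 + x^2)
     = (((1 + 3 * x^2) * Q - x * (1 + x^2) * (6 * p * x - 4 * (1 - p) * x^3)) * (1 + x^2) - Q^2)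
        / (Q^2 * (1 + x^2))"
    using Q S by (simp add: diff_frac_eq)
  moreover have "((1 + 3 * x^2) * Q - x * (1 + x^2) * (6 * p * x - 4 * (1 - p) * x^3)) * (1 + x^2) - Q^2
     = x^2 * slope_cubic p (x^2)"
    unfolding Q_def slope_cubic_def by algebra
  ultimately show ?thesis
    unfolding eq Q_def by simp
qed

lemma derivative_sign_iff:
  assumes p: "0 < p" "p < 1" and x: "0 < x" "x \<le> 1"
  shows "x^2 * slope_cubic p (x^2) / ((1 + 3 * p * x^2 - (1 - p) * x^4)^2 * (1 + x^2)) > 0
           \<longleftrightarrow> slope_cubic p (x^2) > 0"
    and "x^2 * slope_cubic p (x^2) / ((1 + 3 * p * x^2 - (1 - p) * x^4)^2 * (1 + x^2)) < 0
           \<longleftrightarrow> slope_cubic p (x^2) < 0"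
proof -
  have "(1 + 3 * p * x^2 - (1 - p) * x^4)^2 * (1 + x^2) > 0"
    using mix_denominator_pos[of p x] assms by (intro mult_pos_pos) (auto simp: add_pos_nonneg)
  then show "x^2 * slope_cubic p (x^2) / ((1 + 3 * p * x^2 - (1 - p) * x^4)^2 * (1 + x^2)) > 0
           \<longleftrightarrow> slope_cubic p (x^2) > 0"
    and "x^2 * slope_cubic p (x^2) / ((1 + 3 * p * x^2 - (1 - p) * x^4)^2 * (1 + x^2)) < 0
           \<longleftrightarrow> slope_cubic p (x^2) < 0"
    using x by (simp_all add: zero_less_divide_iff divide_less_0_iff zero_less_mult_iff mult_less_0_iff)
qed

lemma mix_pos:
  assumes "0 < p" "p < 1" "0 \<le> x" "x \<le> 1"
  shows "mix p x > 0"
  unfolding mix_def using mix_denominator_pos[OF assms] by (simp add: add_pos_nonneg)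

section \<open>The two sharp inequalities\<close>

lemma mix_lt_seiffert:
  assumes x: "0 < x" "x < 1"
  shows "mix (4 / 9) x < x / arctan x"
proof -
  let ?f = "\<lambda>x. x / mix (4 / 9) x - arctan x"
  obtain z where z: "0 < z" "z < x" and d: "?f x - ?f 0 = (x - 0) *
     (z^2 * slope_cubic (4 / 9) (z^2) / ((1 + 3 * (4 / 9) * z^2 - (1 - 4 / 9) * z^4)^2 * (1 + z^2)))"
    using MVT2[OF x(1), of ?f] DERIV_ratio_minus_arctan[of "4 / 9"] x by fastforce
  have "slope_cubic (4 / 9) (z^2) > slope_cubic (4 / 9) 0"
    using z by (intro slope_cubic_strict_mono) auto
  then have "slope_cubic (4 / 9) (z^2) > 0"
    by (simp add: slope_cubic_def)
  with derivative_sign_iff(1)[of "4 / 9" z] z x have "?f x - ?f 0 > 0"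
    unfolding d by (intro mult_pos_pos) auto
  then have "?f x > 0" by simp
  then show ?thesis
    using mix_pos[of "4 / 9" x] x by (simp add: field_simps)
qed

lemma two_div_pi_le_two_thirds: "2 / pi \<le> 2 / 3"
proof -
  \<comment> \<open>\<open>\<pi> \<ge> 3\<close>, because \<open>1 / 2 = sin (\<pi> / 6) \<le> \<pi> / 6\<close>\<close>
  have "sin (pi / 6) \<le> pi / 6" by (rule sin_x_le_x) simp
  then have "pi \<ge> 3" by (simp add: sin_30)
  then show ?thesis by (intro divide_left_mono) auto
qed

lemma seiffert_lt_mix:
  assumes x: "0 < x" "x < 1"
  shows "x / arctan x < mix (2 / pi) x"
proof -
  define p where "p = 2 / pi"
  have p0: "0 < p" and p23: "p \<le> 2 / 3"
    unfolding p_def using two_div_pi_le_two_thirds by simp_all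
  have p1: "p < 1" using p23 by linarith
  note p = p0 p23 p1
  let ?f = "\<lambda>x. x / mix p x - arctan x"
  let ?f' = "\<lambda>x. x^2 * slope_cubic p (x^2) / ((1 + 3 * p * x^2 - (1 - p) * x^4)^2 * (1 + x^2))"
  have f1: "?f 1 = 0"
    by (simp add: mix_def p_def arctan_one)
  have D: "(?f has_real_derivative ?f' y) (at y)" if "0 \<le> y" "y \<le> 1" for y
    using DERIV_ratio_minus_arctan that p by blast
  \<comment> \<open>Otherwise the mean value theorem on both sides of \<open>x\<close> makes the derivative nonnegative at
    some \<open>u < x\<close> and nonpositive at some \<open>v > x\<close>, against the monotonicity of the cubic.\<close>
  have "?f x < 0"
  proof (rule ccontr)
    assume "\<not> ?f x < 0"
    obtain u where u: "0 < u" "u < x" "?f x - ?f 0 = (x - 0) * ?f' u"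
      using MVT2[OF x(1), of ?f ?f'] D x by fastforce
    obtain v where v: "x < v" "v < 1" "?f 1 - ?f x = (1 - x) * ?f' v"
      using MVT2[OF x(2), of ?f ?f'] D x by fastforce
    have "\<not> ?f' u < 0"
      using u \<open>\<not> ?f x < 0\<close> x mult_pos_neg[of x "?f' u"] by auto
    moreover have "\<not> ?f' v > 0"
      using v f1 \<open>\<not> ?f x < 0\<close> x mult_pos_pos[of "1 - x" "?f' v"] by auto
    ultimately have "slope_cubic p (u^2) \<ge> 0" "slope_cubic p (v^2) \<le> 0"
      using derivative_sign_iff(2)[of p u] derivative_sign_iff(1)[of p v] p u v x by auto
    moreover have "slope_cubic p (u^2) < slope_cubic p (v^2)"
      using p u v by (intro slope_cubic_strict_mono power_strict_mono) auto
    ultimately show False by linarith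
  qed
  then show ?thesis
    using mix_pos[of p x] p x by (simp add: field_simps p_def[symmetric])
qed

section \<open>Necessity of the bounds on the weights\<close>

lemma arctan_ge_cubic:
  assumes "0 \<le> x"
  shows "x - x^3 / 3 \<le> arctan x"
proof -
  have "arctan 0 - (0 - 0^3 / 3) \<le> arctan x - (x - x^3 / 3)"
  proof (rule DERIV_nonneg_imp_nondecreasing[OF assms])
    fix y :: real
    have S: "1 + y^2 > 0" by (simp add: add_pos_nonneg)
    have "((\<lambda>x. arctan x - (x - x^3 / 3)) has_real_derivative 1 / (1 + y^2) - (1 - y^2)) (at y)"
      by (auto intro!: derivative_eq_intros simp: inverse_eq_divide)
    moreover have "1 / (1 + y^2) - (1 - y^2) = y^4 / (1 + y^2)"
      using S by (simp add: field_simps)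
    moreover have "y^4 / (1 + y^2) \<ge> 0" using S by simp
    ultimately show "\<exists>d. ((\<lambda>x. arctan x - (x - x^3 / 3)) has_real_derivative d) (at y) \<and> 0 \<le> d"
      by auto
  qed
  then show ?thesis by simp
qed

text \<open>Both sides of the inequality at \<open>x\<close> tend to \<open>1\<close> as \<open>x\<close> tends to \<open>0\<close>; the condition on \<open>\<alpha>\<close>
  appears after subtracting \<open>1 - x\<^sup>2\<close> (the harmonic mean) and dividing by \<open>x\<^sup>2\<close>.\<close>

lemma lower_weight_le:
  assumes "\<And>x. 0 < x \<Longrightarrow> x < 1 \<Longrightarrow> mix \<alpha> x < x / arctan x"
  shows "\<alpha> \<le> 4 / 9"
proof -
  have ev: "\<alpha> * (3 + x^2) \<le> (1 / (3 - x^2) + 1) * (1 + x^2)" if x: "0 < x" "x < 1" for x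
  proof -
    have x2: "0 < x^2" "x^2 < 1" using x by (auto simp: power_less_one_iff)
    have "x - x^3 / 3 = x * (3 - x^2) / 3"
      by (simp add: power2_eq_square power3_eq_cube algebra_simps)
    moreover have "x * (3 - x^2) / 3 > 0" using x x2 by simp
    ultimately have "x / arctan x \<le> x / (x * (3 - x^2) / 3)"
      using arctan_ge_cubic[of x] x by (intro divide_left_mono) auto
    also have "\<dots> = 3 / (3 - x^2)" using x by simp
    finally have "mix \<alpha> x < 3 / (3 - x^2)" using assms[OF x] by linarith
    moreover have "mix \<alpha> x = 1 - x^2 + x^2 * (\<alpha> * (3 + x^2) / (1 + x^2))"
      unfolding mix_def using add_pos_pos[OF zero_less_one x2(1)]
      by (simp add: divide_eq_eq distrib_right) algebra
    moreover have "3 / (3 - x^2) = 1 - x^2 + x^2 * (1 / (3 - x^2) + 1)"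
      using x2 by (simp add: field_simps)
    ultimately have "x^2 * (\<alpha> * (3 + x^2) / (1 + x^2)) < x^2 * (1 / (3 - x^2) + 1)"
      by linarith
    then have "\<alpha> * (3 + x^2) / (1 + x^2) < 1 / (3 - x^2) + 1"
      using x2 by (simp only: mult_less_cancel_left_pos)
    then show ?thesis
      using x2 by (simp only: pos_divide_less_eq add_pos_pos zero_less_one less_imp_le)
  qed
  have "((\<lambda>x. \<alpha> * (3 + x^2)) \<longlongrightarrow> \<alpha> * (3 + 0^2)) (at_right 0)"
    by (intro tendsto_intros)
  moreover have "((\<lambda>x::real. (1 / (3 - x^2) + 1) * (1 + x^2)) \<longlongrightarrow> (1 / (3 - 0^2) + 1) * (1 + 0^2))
      (at_right 0)"
    by (intro tendsto_intros) auto
  moreover have "\<forall>\<^sub>F x in at_right 0. \<alpha> * (3 + x^2) \<le> (1 / (3 - x^2) + 1) * (1 + x^2)"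
    unfolding eventually_at_right_field using ev by (intro exI[of _ 1]) auto
  ultimately have "\<alpha> * (3 + 0^2) \<le> (1 / (3 - 0^2) + 1) * (1 + 0^2)"
    by (intro tendsto_le[OF trivial_limit_at_right_real])
  then show ?thesis by simp
qed

lemma upper_weight_ge:
  assumes "\<And>x. 0 < x \<Longrightarrow> x < 1 \<Longrightarrow> x / arctan x < mix \<beta> x"
  shows "\<beta> \<ge> 2 / pi"
proof -
  have "((\<lambda>x::real. x / arctan x) \<longlongrightarrow> 1 / arctan 1) (at_left 1)"
    by (intro tendsto_intros) (simp add: arctan_one)
  moreover have "(mix \<beta> \<longlongrightarrow> mix \<beta> 1) (at_left 1)"
    unfolding mix_def by (intro tendsto_intros) simp
  moreover have "\<forall>\<^sub>F x in at_left 1. x / arctan x \<le> mix \<beta> x"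
    unfolding eventually_at_left_field using assms by (intro exI[of _ 0]) (auto intro: less_imp_le)
  ultimately have "1 / arctan 1 \<le> mix \<beta> 1"
    by (intro tendsto_le[OF trivial_limit_at_left_real])
  then show ?thesis by (simp add: mix_def arctan_one)
qed

section \<open>The optimal weights\<close>

theorem theorem3p1:
  fixes \<alpha> \<beta> :: real
  shows "(\<forall>a b :: real. a > 0 \<longrightarrow> b > 0 \<longrightarrow> a \<noteq> b \<longrightarrow>
            \<alpha> * second_contraharmonic_mean a b + (1 - \<alpha>) * harmonic_mean a b < seiffert_mean a b \<and>
            seiffert_mean a b < \<beta> * second_contraharmonic_mean a b + (1 - \<beta>) * harmonic_mean a b)
         \<longleftrightarrow> \<alpha> \<le> 4 / 9 \<and> \<beta> \<ge> 2 / pi"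
  unfolding mean_inequality_iff_mix
proof (intro iffI conjI allI impI)
  assume *: "\<forall>x. 0 < x \<longrightarrow> x < 1 \<longrightarrow> mix \<alpha> x < x / arctan x \<and> x / arctan x < mix \<beta> x"
  show "\<alpha> \<le> 4 / 9" using * by (intro lower_weight_le) auto
  show "\<beta> \<ge> 2 / pi" using * by (intro upper_weight_ge) auto
next
  fix x :: real
  assume "\<alpha> \<le> 4 / 9 \<and> \<beta> \<ge> 2 / pi" and x: "0 < x" "x < 1"
  then have "mix \<alpha> x \<le> mix (4 / 9) x" "mix (2 / pi) x \<le> mix \<beta> x"
    by (auto intro: mix_mono)
  then show "mix \<alpha> x < x / arctan x" "x / arctan x < mix \<beta> x"
    using mix_lt_seiffert[OF x] seiffert_lt_mix[OF x] by linarith+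
qed

end
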